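(* Let $\ell_1=\ell_2=1$, let $Q\in T^*{\mathcal C}$ be a point with $H(Q)=\frac12$, and let $g=G(Q)$. Let $x(t)$ be the projection to $\mathbb{R}^2$ of the trajectory $Q(t)$ of the Hamiltonian vector field $X_H$ with $Q(0)=Q$, with Frenet frame $(T(t),N(t))$ and curvature $\kappa(t)$. Let $\xi(t)$ be the vector field along $x(t)$ obtained by projecting to $\mathbb{R}^2$ the Hamiltonian vector field $X_G$ at the points $Q(t)$, and write $\xi=uT+vN$. Then $$u(t)=1+g-\frac12\kappa^2(t),\qquad v(t)=-\dot\kappa(t).$$
   Context: ${\mathcal C}=\{(x_1,x_2,\alpha_1,\alpha_2)\in\mathbb{R}^2\times T^2:\alpha_1\ne\alpha_2\}$ is the configuration space of 2-linkages $x,m_1,m_2$ with $x=(x_1,x_2)$, $m_i=x-(\cos\alpha_i,\sin\alpha_i)$. On $T^*{\mathcal C}$ use coordinates $(x_1,x_2,\alpha_1,\alpha_2,p_1,p_2,\eta_1,\eta_2)$, the last four being fiber coordinates conjugate to the first four, with the standard symplectic form; the Hamiltonian vector field $X_F$ is given by $\dot x_i=F_{p_i}$, $\dot\alpha_i=F_{\eta_i}$, $\dot p_i=-F_{x_i}$, $\dot\eta_i=-F_{\alpha_i}$. Projection to $\mathbb{R}^2$ means the map to $(x_1,x_2)$. The (Poisson commuting) functions $H$ and $G$ are $$H=\frac12\left[(p_1-\eta_1\sin\alpha_1-\eta_2\sin\alpha_2)^2+(p_2+\eta_1\cos\alpha_1+\eta_2\cos\alpha_2)^2\right],$$ $$G=p_1(p_1-\eta_1\sin\alpha_1-\eta_2\sin\alpha_2)+p_2(p_2+\eta_1\cos\alpha_1+\eta_2\cos\alpha_2)+\frac12(\eta_1+\eta_2)^2.$$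 On $H=\frac12$ the curve $x(t)$ is parameterized by arc length; $T=\dot x=(\cos\gamma,\sin\gamma)$, $N=(-\sin\gamma,\cos\gamma)$, $\kappa=\dot\gamma$. *)

theory Defs
  imports "HOL-Analysis.Analysis"
begin

text \<open>
  A point \<open>(x, \<alpha>, p, \<eta>)\<close> collects the coordinates \<open>(x\<^sub>1, x\<^sub>2)\<close>, \<open>(\<alpha>\<^sub>1, \<alpha>\<^sub>2)\<close>,
  \<open>(p\<^sub>1, p\<^sub>2)\<close>, \<open>(\<eta>\<^sub>1, \<eta>\<^sub>2)\<close>.  The angles are real representatives of points of the
  torus \<open>T\<^sup>2 = (\<real> / 2 \<pi> \<int>)\<^sup>2\<close>; the two \<open>periodic\<close> lemmas below show that the
  functions \<open>linkage_H\<close>, \<open>linkage_G\<close> and the set \<open>cotangent_space\<close> do not depend on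
  the choice of representatives.
\<close>

type_synonym phase_point = "(real^2) \<times> (real^2) \<times> (real^2) \<times> (real^2)"

text \<open>Inequality of the two angles is inequality on the circle, i.e. modulo \<open>2 \<pi>\<close>.\<close>

definition config_space :: "((real^2) \<times> (real^2)) set" where
  "config_space = {(x, \<alpha>). cis (\<alpha>$1) \<noteq> cis (\<alpha>$2)}"

definition cotangent_space :: "phase_point set" where
  "cotangent_space = {(x, \<alpha>, p, \<eta>). (x, \<alpha>) \<in> config_space}"

definition base_proj :: "phase_point \<Rightarrow> real^2" where
  "base_proj = (\<lambda>(x, \<alpha>, p, \<eta>). x)"

definition linkage_H :: "phase_point \<Rightarrow> real" where
  "linkage_H = (\<lambda>(x, \<alpha>, p, \<eta>).
     1/2 * ((p$1 - \<eta>$1 * sin (\<alpha>$1) - \<eta>$2 * sin (\<alpha>$2))\<^sup>2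
          + (p$2 + \<eta>$1 * cos (\<alpha>$1) + \<eta>$2 * cos (\<alpha>$2))\<^sup>2))"

definition linkage_G :: "phase_point \<Rightarrow> real" where
  "linkage_G = (\<lambda>(x, \<alpha>, p, \<eta>).
       p$1 * (p$1 - \<eta>$1 * sin (\<alpha>$1) - \<eta>$2 * sin (\<alpha>$2))
     + p$2 * (p$2 + \<eta>$1 * cos (\<alpha>$1) + \<eta>$2 * cos (\<alpha>$2))
     + 1/2 * (\<eta>$1 + \<eta>$2)\<^sup>2)"

definition gradient :: "(real^2 \<Rightarrow> real) \<Rightarrow> real^2 \<Rightarrow> real^2" where
  "gradient f y = (\<chi> i. deriv (\<lambda>s. f (y + s *\<^sub>R axis i 1)) 0)"

definition hamiltonian_field :: "(phase_point \<Rightarrow> real) \<Rightarrow> phase_point \<Rightarrow> phase_point" where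
  "hamiltonian_field F = (\<lambda>(x, \<alpha>, p, \<eta>).
     (gradient (\<lambda>p'. F (x, \<alpha>, p', \<eta>)) p,
      gradient (\<lambda>\<eta>'. F (x, \<alpha>, p, \<eta>')) \<eta>,
      - gradient (\<lambda>x'. F (x', \<alpha>, p, \<eta>)) x,
      - gradient (\<lambda>\<alpha>'. F (x, \<alpha>', p, \<eta>)) \<alpha>))"

definition trajectory ::
  "(phase_point \<Rightarrow> phase_point) \<Rightarrow> real set \<Rightarrow> (real \<Rightarrow> phase_point) \<Rightarrow> bool" where
  "trajectory X I Q \<longleftrightarrow>
     (\<forall>t\<in>I. Q t \<in> cotangent_space \<and> (Q has_vector_derivative X (Q t)) (at t))"

text \<open>
  Frenet frame and signed curvature of a plane curve parameterized by arc length on an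
  open interval; \<open>\<gamma>\<close> is the turning angle of the tangent.
\<close>

definition frenet_frame ::
  "real set \<Rightarrow> (real \<Rightarrow> real^2) \<Rightarrow> (real \<Rightarrow> real^2) \<Rightarrow> (real \<Rightarrow> real^2) \<Rightarrow> (real \<Rightarrow> real) \<Rightarrow> bool" where
  "frenet_frame I x T N \<kappa> \<longleftrightarrow>
     (\<exists>\<gamma>. \<forall>t\<in>I. (x has_vector_derivative T t) (at t)
        \<and> T t = vector [cos (\<gamma> t), sin (\<gamma> t)]
        \<and> N t = vector [- sin (\<gamma> t), cos (\<gamma> t)]
        \<and> (\<gamma> has_real_derivative \<kappa> t) (at t))"

lemma linkage_functions_periodic:
  assumes "cis (\<alpha>$1) = cis (\<beta>$1)" and "cis (\<alpha>$2) = cis (\<beta>$2)"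
  shows "linkage_H (x, \<alpha>, p, \<eta>) = linkage_H (x, \<beta>, p, \<eta>)"
    and "linkage_G (x, \<alpha>, p, \<eta>) = linkage_G (x, \<beta>, p, \<eta>)"
  using assms by (simp_all add: linkage_H_def linkage_G_def complex_eq_iff)

lemma cotangent_space_periodic:
  assumes "cis (\<alpha>$1) = cis (\<beta>$1)" and "cis (\<alpha>$2) = cis (\<beta>$2)"
  shows "(x, \<alpha>, p, \<eta>) \<in> cotangent_space \<longleftrightarrow> (x, \<beta>, p, \<eta>) \<in> cotangent_space"
  using assms by (simp add: cotangent_space_def config_space_def)

end

theory Submission
  imports Defs
begin

text \<open>
  Write \<open>V = (A, B)\<close> with \<open>A = p\<^sub>1 - \<Sum> \<eta>\<^sub>i sin \<alpha>\<^sub>i\<close> and \<open>B = p\<^sub>2 + \<Sum> \<eta>\<^sub>i cos \<alpha>\<^sub>i\<close>, so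
  that \<open>H = (A\<^sup>2 + B\<^sup>2) / 2\<close>.  As \<open>V\<close> is \<open>p\<close> plus a term independent of \<open>p\<close>, the
  gradient of \<open>H\<close> in \<open>p\<close> is \<open>V\<close>: the flow of \<open>H\<close> moves \<open>x\<close> with velocity \<open>V\<close>.
  Differentiating \<open>A\<close> and \<open>B\<close> along the flow, the terms in the individual angles
  collapse by \<open>sin\<^sup>2 + cos\<^sup>2 = 1\<close>, and what remains is a rotation:
  \<open>A' = - w B\<close>, \<open>B' = w A\<close> with \<open>w = \<eta>\<^sub>1 + \<eta>\<^sub>2\<close>.  As \<open>V\<close> has unit length on
  \<open>H = 1/2\<close>, it is the tangent \<open>T\<close>, and \<open>w\<close> is the curvature.

  The momentum \<open>p\<close> is constant because \<open>H\<close> does not depend on \<open>x\<close>, and the sums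
  \<open>\<Sum> \<eta>\<^sub>i sin \<alpha>\<^sub>i = p\<^sub>1 - A\<close> and \<open>\<Sum> \<eta>\<^sub>i cos \<alpha>\<^sub>i = B - p\<^sub>2\<close> turn the derivative of
  \<open>w\<close> into \<open>w' = p\<^sub>1 B - p\<^sub>2 A = - p \<bullet> N\<close>.  Moreover \<open>G = p \<bullet> V + w\<^sup>2 / 2\<close>, which
  is conserved by these equations, and \<open>X\<^sub>G\<close> projects to \<open>\<xi> = V + p\<close>.  Hence
  \<open>u = 1 + p \<bullet> T = 1 + g - w\<^sup>2 / 2\<close> and \<open>v = p \<bullet> N = - w'\<close>.

  It remains to relate \<open>w\<close> to turning angles.  Integrating \<open>w\<close> yields one, so a Frenet
  frame exists on the whole interval (\<open>rotating_unit_vector_lift\<close>), and every turning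
  angle of the curve has derivative \<open>w\<close> (\<open>rotation_rate_unique\<close>).
\<close>

section \<open>Hamiltonian vector fields of the two functions\<close>

definition velocity :: "phase_point \<Rightarrow> real^2" where
  "velocity = (\<lambda>(x, \<alpha>, p, \<eta>).
     vector [p$1 - \<eta>$1 * sin (\<alpha>$1) - \<eta>$2 * sin (\<alpha>$2),
             p$2 + \<eta>$1 * cos (\<alpha>$1) + \<eta>$2 * cos (\<alpha>$2)])"

definition momentum :: "phase_point \<Rightarrow> real^2" where
  "momentum = (\<lambda>(x, \<alpha>, p, \<eta>). p)"

definition turning_rate :: "phase_point \<Rightarrow> real" where
  "turning_rate = (\<lambda>(x, \<alpha>, p, \<eta>). \<eta>$1 + \<eta>$2)"

lemma linkage_H_eq_velocity:
  "linkage_H q = ((velocity q $ 1)\<^sup>2 + (velocity q $ 2)\<^sup>2) / 2"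
  by (cases q) (simp add: linkage_H_def velocity_def)

lemma linkage_G_eq_velocity:
  "linkage_G q = momentum q $ 1 * velocity q $ 1 + momentum q $ 2 * velocity q $ 2
     + (turning_rate q)\<^sup>2 / 2"
  by (cases q) (simp add: linkage_G_def velocity_def momentum_def turning_rate_def)

lemma gradient_eqI:
  assumes "((\<lambda>s. f (y + s *\<^sub>R axis 1 1)) has_real_derivative d $ 1) (at 0)"
    and "((\<lambda>s. f (y + s *\<^sub>R axis 2 1)) has_real_derivative d $ 2) (at 0)"
  shows "gradient f y = d"
  using assms by (simp add: gradient_def vec_eq_iff forall_2 DERIV_imp_deriv)

lemma hamiltonian_field_linkage_H:
  fixes x \<alpha> p \<eta> :: "real^2"
  defines "V \<equiv> velocity (x, \<alpha>, p, \<eta>)"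
  shows "hamiltonian_field linkage_H (x, \<alpha>, p, \<eta>) =
    (V, \<chi> i. V$2 * cos (\<alpha>$i) - V$1 * sin (\<alpha>$i),
     0, \<chi> i. \<eta>$i * (V$1 * cos (\<alpha>$i) + V$2 * sin (\<alpha>$i)))"
proof -
  have "gradient (\<lambda>p'. linkage_H (x, \<alpha>, p', \<eta>)) p = V"
    by (rule gradient_eqI)
       (auto simp: linkage_H_def V_def velocity_def axis_def intro!: derivative_eq_intros)
  moreover have "gradient (\<lambda>\<eta>'. linkage_H (x, \<alpha>, p, \<eta>')) \<eta>
      = (\<chi> i. V$2 * cos (\<alpha>$i) - V$1 * sin (\<alpha>$i))"
    by (rule gradient_eqI)
       (auto simp: linkage_H_def V_def velocity_def axis_def intro!: derivative_eq_intros)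
  moreover have "gradient (\<lambda>x'. linkage_H (x', \<alpha>, p, \<eta>)) x = 0"
    by (rule gradient_eqI) (simp_all add: linkage_H_def)
  moreover have "gradient (\<lambda>\<alpha>'. linkage_H (x, \<alpha>', p, \<eta>)) \<alpha>
      = - (\<chi> i. \<eta>$i * (V$1 * cos (\<alpha>$i) + V$2 * sin (\<alpha>$i)))"
    by (rule gradient_eqI)
       (auto simp: linkage_H_def V_def velocity_def axis_def field_simps
             intro!: derivative_eq_intros)
  ultimately show ?thesis
    by (simp add: hamiltonian_field_def)
qed

lemma base_proj_hamiltonian_field_linkage_G:
  "base_proj (hamiltonian_field linkage_G q) = velocity q + momentum q"
proof (cases q)
  case (fields x \<alpha> p \<eta>)
  have "gradient (\<lambda>p'. linkage_G (x, \<alpha>, p', \<eta>)) p = velocity q + p"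
    by (rule gradient_eqI)
       (auto simp: linkage_G_def fields velocity_def axis_def intro!: derivative_eq_intros)
  then show ?thesis
    by (simp add: fields hamiltonian_field_def base_proj_def momentum_def)
qed

section \<open>Equations of motion\<close>

text \<open>
  These equations close up: they involve the angles and the individual \<open>\<eta>\<^sub>i\<close> only through
  \<open>velocity\<close> and \<open>turning_rate\<close>.  For the velocity, both \<open>\<alpha>\<^sub>i'\<close> and \<open>\<eta>\<^sub>i'\<close> contribute,
  and the \<open>i\<close>-th contributions add up to \<open>\<eta>\<^sub>i\<close> times \<open>V\<close> turned by a right angle.
\<close>

lemma trajectory_linkage_H_derivatives:
  assumes "trajectory (hamiltonian_field linkage_H) I Q" and "t \<in> I"
  shows "((\<lambda>t. base_proj (Q t)) has_vector_derivative velocity (Q t)) (at t)"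
    and "((\<lambda>t. momentum (Q t) $ i) has_real_derivative 0) (at t)"
    and "((\<lambda>t. velocity (Q t) $ 1) has_real_derivative
           - (turning_rate (Q t) * velocity (Q t) $ 2)) (at t)"
    and "((\<lambda>t. velocity (Q t) $ 2) has_real_derivative
           turning_rate (Q t) * velocity (Q t) $ 1) (at t)"
    and "((\<lambda>t. turning_rate (Q t)) has_real_derivative
           momentum (Q t) $ 1 * velocity (Q t) $ 2 - momentum (Q t) $ 2 * velocity (Q t) $ 1) (at t)"
proof -
  define x where "x = (\<lambda>t. fst (Q t))"
  define \<alpha> where "\<alpha> = (\<lambda>t. fst (snd (Q t)))"
  define p where "p = (\<lambda>t. fst (snd (snd (Q t))))"
  define \<eta> where "\<eta> = (\<lambda>t. snd (snd (snd (Q t))))"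
  have Q: "Q t = (x t, \<alpha> t, p t, \<eta> t)" for t
    by (simp add: x_def \<alpha>_def p_def \<eta>_def)
  define V where "V = velocity (Q t)"
  have "(Q has_vector_derivative hamiltonian_field linkage_H (Q t)) (at t)"
    using assms by (simp add: trajectory_def)
  then have der: "(Q has_vector_derivative
      (V, \<chi> i. V$2 * cos (\<alpha> t$i) - V$1 * sin (\<alpha> t$i),
       0, \<chi> i. \<eta> t$i * (V$1 * cos (\<alpha> t$i) + V$2 * sin (\<alpha> t$i)))) (at t)"
    by (simp add: Q V_def hamiltonian_field_linkage_H)
  note fst' = bounded_linear.has_vector_derivative[OF bounded_linear_fst]
  note snd' = bounded_linear.has_vector_derivative[OF bounded_linear_snd]
  note nth' = bounded_linear.has_vector_derivative[OF bounded_linear_vec_nth]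
  have dx: "(x has_vector_derivative V) (at t)"
    using fst'[OF der] by (simp add: x_def)
  have d\<alpha>: "((\<lambda>t. \<alpha> t $ i) has_real_derivative V$2 * cos (\<alpha> t$i) - V$1 * sin (\<alpha> t$i)) (at t)" for i
    using nth'[OF fst'[OF snd'[OF der]], of i]
    by (simp add: \<alpha>_def has_real_derivative_iff_has_vector_derivative)
  have dp: "((\<lambda>t. p t $ i) has_real_derivative 0) (at t)" for i
    using nth'[OF fst'[OF snd'[OF snd'[OF der]]], of i]
    by (simp add: p_def has_real_derivative_iff_has_vector_derivative)
  have d\<eta>: "((\<lambda>t. \<eta> t $ i) has_real_derivative
      \<eta> t$i * (V$1 * cos (\<alpha> t$i) + V$2 * sin (\<alpha> t$i))) (at t)" for i
    using nth'[OF snd'[OF snd'[OF snd'[OF der]]], of i]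
    by (simp add: \<eta>_def has_real_derivative_iff_has_vector_derivative)
  have V: "V$1 = p t$1 - \<eta> t$1 * sin (\<alpha> t$1) - \<eta> t$2 * sin (\<alpha> t$2)"
          "V$2 = p t$2 + \<eta> t$1 * cos (\<alpha> t$1) + \<eta> t$2 * cos (\<alpha> t$2)"
    by (simp_all add: V_def Q velocity_def)
  have sc: "sin (\<alpha> t$i) * sin (\<alpha> t$i) = 1 - cos (\<alpha> t$i) * cos (\<alpha> t$i)" for i
    using sin_cos_squared_add[of "\<alpha> t$i"] by (simp add: power2_eq_square)
  show "((\<lambda>t. base_proj (Q t)) has_vector_derivative velocity (Q t)) (at t)"
    using dx by (simp add: base_proj_def Q V_def)
  show "((\<lambda>t. momentum (Q t) $ i) has_real_derivative 0) (at t)"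
    using dp by (simp add: momentum_def Q)
  have "((\<lambda>t. p t$1 - \<eta> t$1 * sin (\<alpha> t$1) - \<eta> t$2 * sin (\<alpha> t$2))
      has_real_derivative - ((\<eta> t$1 + \<eta> t$2) * V$2)) (at t)"
    apply (rule derivative_eq_intros dp d\<eta> d\<alpha> refl)+
    using sc[of 1] sc[of 2] by algebra
  then show "((\<lambda>t. velocity (Q t) $ 1) has_real_derivative
           - (turning_rate (Q t) * velocity (Q t) $ 2)) (at t)"
    by (simp add: V_def Q velocity_def turning_rate_def)
  have "((\<lambda>t. p t$2 + \<eta> t$1 * cos (\<alpha> t$1) + \<eta> t$2 * cos (\<alpha> t$2))
      has_real_derivative (\<eta> t$1 + \<eta> t$2) * V$1) (at t)"
    apply (rule derivative_eq_intros dp d\<eta> d\<alpha> refl)+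
    using sc[of 1] sc[of 2] by algebra
  then show "((\<lambda>t. velocity (Q t) $ 2) has_real_derivative
           turning_rate (Q t) * velocity (Q t) $ 1) (at t)"
    by (simp add: V_def Q velocity_def turning_rate_def)
  have "((\<lambda>t. \<eta> t$1 + \<eta> t$2) has_real_derivative p t$1 * V$2 - p t$2 * V$1) (at t)"
    apply (rule derivative_eq_intros d\<eta> refl)+
    using V by algebra
  then show "((\<lambda>t. turning_rate (Q t)) has_real_derivative
           momentum (Q t) $ 1 * velocity (Q t) $ 2 - momentum (Q t) $ 2 * velocity (Q t) $ 1) (at t)"
    unfolding V_def by (simp add: Q momentum_def turning_rate_def)
qed

section \<open>Turning angles\<close>

lemma constant_on_interval_if_DERIV_zero:
  fixes f :: "real \<Rightarrow> real"
  assumes "is_interval I" and "\<And>t. t \<in> I \<Longrightarrow> (f has_real_derivative 0) (at t)"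
    and "a \<in> I" and "t \<in> I"
  shows "f t = f a"
proof -
  have "convex I" using assms(1) by (rule is_interval_convex)
  moreover have "\<And>t. t \<in> I \<Longrightarrow> (f has_real_derivative 0) (at t within I)"
    using assms(2) has_field_derivative_at_within by blast
  ultimately obtain c where "\<forall>t\<in>I. f t = c"
    using has_field_derivative_zero_constant by metis
  then show ?thesis using assms(3,4) by simp
qed


text \<open>
  An open interval consists of the reals strictly between its infimum and its supremum in the
  extended reals; this puts \<open>I\<close> in the form to which \<open>einterval_antiderivative\<close> applies.
\<close>

lemma antiderivative_on_open_interval:
  fixes f :: "real \<Rightarrow> real"
  assumes "open I" and "is_interval I" and "continuous_on I f"
  shows "\<exists>F. \<forall>t\<in>I. (F has_real_derivative f t) (at t)"
proof (cases "I = {}")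
  case False
  define a where "a = (INF t\<in>I. ereal t)"
  define b where "b = (SUP t\<in>I. ereal t)"
  have between: "a < ereal t \<and> ereal t < b" if "t \<in> I" for t
  proof -
    obtain e where e: "e > 0" "cball t e \<subseteq> I"
      using open_contains_cball_eq[OF \<open>open I\<close>] \<open>t \<in> I\<close> by blast
    then have "t - e \<in> I" "t + e \<in> I"
      by (auto simp: subset_iff dist_real_def)
    then have "a \<le> ereal (t - e)" "ereal (t + e) \<le> b"
      unfolding a_def b_def by (auto intro: INF_lower SUP_upper)
    moreover have "ereal (t - e) < ereal t" "ereal t < ereal (t + e)"
      using e by simp_all
    ultimately show ?thesis
      using le_less_trans less_le_trans by blast
  qed
  have inside: "t \<in> I" if bounds: "a < ereal t" "ereal t < b" for t
  proof -
    obtain r s where "r \<in> I" "r < t" "s \<in> I" "t < s"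
      using bounds by (auto simp: a_def b_def INF_less_iff less_SUP_iff)
    then show ?thesis
      using \<open>is_interval I\<close> unfolding is_interval_1 by (meson less_imp_le)
  qed
  have "a < b"
    using False between by (meson ex_in_conv less_trans)
  moreover have "isCont f t" if "a < ereal t" "ereal t < b" for t
    using inside[OF that] assms(1,3) by (simp add: continuous_on_eq_continuous_at)
  ultimately obtain F where
    "\<forall>t. a < ereal t \<longrightarrow> ereal t < b \<longrightarrow> (F has_vector_derivative f t) (at t)"
    using einterval_antiderivative by metis
  then show ?thesis
    using between by (auto simp: has_real_derivative_iff_has_vector_derivative)
qed simp

text \<open>
  An angle \<open>\<gamma>\<close> is built by integrating the rotation rate from a correct initial value.
  Both \<open>(a, b)\<close> and \<open>(cos \<gamma>, sin \<gamma>)\<close> then rotate at rate \<open>w\<close>, so their inner product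
  keeps its initial value \<open>1\<close>, and two unit vectors with inner product \<open>1\<close> coincide.
\<close>

lemma rotating_unit_vector_lift:
  fixes a b w :: "real \<Rightarrow> real"
  assumes "open I" and "is_interval I" and "continuous_on I w"
    and a: "\<And>t. t \<in> I \<Longrightarrow> (a has_real_derivative - (w t * b t)) (at t)"
    and b: "\<And>t. t \<in> I \<Longrightarrow> (b has_real_derivative w t * a t) (at t)"
    and unit: "\<And>t. t \<in> I \<Longrightarrow> (a t)\<^sup>2 + (b t)\<^sup>2 = 1"
  shows "\<exists>\<gamma>. \<forall>t\<in>I. a t = cos (\<gamma> t) \<and> b t = sin (\<gamma> t)
           \<and> (\<gamma> has_real_derivative w t) (at t)"
proof (cases "I = {}")
  case False
  then obtain t\<^sub>0 where t\<^sub>0: "t\<^sub>0 \<in> I" by blast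
  obtain F where F: "\<And>t. t \<in> I \<Longrightarrow> (F has_real_derivative w t) (at t)"
    using antiderivative_on_open_interval[OF assms(1-3)] by blast
  obtain \<theta> where \<theta>: "a t\<^sub>0 = cos \<theta>" "b t\<^sub>0 = sin \<theta>"
    using sincos_total_2pi[OF unit[OF t\<^sub>0]] by metis
  define \<gamma> where "\<gamma> = (\<lambda>t. \<theta> + (F t - F t\<^sub>0))"
  have d\<gamma>: "(\<gamma> has_real_derivative w t) (at t)" if "t \<in> I" for t
    unfolding \<gamma>_def by (auto intro!: derivative_eq_intros F that)
  have "((\<lambda>t. a t * cos (\<gamma> t) + b t * sin (\<gamma> t)) has_real_derivative 0) (at t)"
    if "t \<in> I" for t
    by (auto intro!: derivative_eq_intros a b d\<gamma> that simp: algebra_simps)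
  then have "a t * cos (\<gamma> t) + b t * sin (\<gamma> t) = a t\<^sub>0 * cos (\<gamma> t\<^sub>0) + b t\<^sub>0 * sin (\<gamma> t\<^sub>0)"
    if "t \<in> I" for t
    using constant_on_interval_if_DERIV_zero[OF \<open>is_interval I\<close> _ t\<^sub>0 that] by blast
  then have inner: "a t * cos (\<gamma> t) + b t * sin (\<gamma> t) = 1" if "t \<in> I" for t
    using that by (simp add: \<gamma>_def \<theta> flip: power2_eq_square)
  have "a t = cos (\<gamma> t) \<and> b t = sin (\<gamma> t)" if "t \<in> I" for t
  proof -
    have "(a t - cos (\<gamma> t))\<^sup>2 + (b t - sin (\<gamma> t))\<^sup>2 = 0"
      using inner[OF that] unit[OF that] sin_cos_squared_add[of "\<gamma> t"]
      by (simp add: power2_diff algebra_simps)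
    then show ?thesis
      by (simp add: sum_power2_eq_zero_iff)
  qed
  with d\<gamma> show ?thesis by blast
qed simp

text \<open>
  Comparing two expressions for the derivative of each component gives \<open>w = k\<close> up to a factor
  \<open>a t\<close> or \<open>b t\<close>, and these are not both zero.
\<close>

lemma rotation_rate_unique:
  fixes a b \<gamma> :: "real \<Rightarrow> real"
  assumes "(a has_real_derivative - (w * b t)) (at t)"
    and "(b has_real_derivative w * a t) (at t)"
    and "\<forall>\<^sub>F s in nhds t. a s = cos (\<gamma> s) \<and> b s = sin (\<gamma> s)"
    and "(\<gamma> has_real_derivative k) (at t)"
  shows "k = w"
proof -
  have ev: "\<forall>\<^sub>F s in nhds t. cos (\<gamma> s) = a s" "\<forall>\<^sub>F s in nhds t. sin (\<gamma> s) = b s"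
    using assms(3) by (auto elim: eventually_mono)
  have ab: "a t = cos (\<gamma> t)" "b t = sin (\<gamma> t)"
    using eventually_nhds_x_imp_x[OF assms(3)] by auto
  have "((\<lambda>s. cos (\<gamma> s)) has_real_derivative - (w * b t)) (at t)"
    using assms(1) DERIV_cong_ev[OF refl ev(1) refl] by blast
  moreover have "((\<lambda>s. cos (\<gamma> s)) has_real_derivative - (k * b t)) (at t)"
    by (auto intro!: derivative_eq_intros assms(4) simp: ab)
  ultimately have 1: "w * b t = k * b t"
    using DERIV_unique by fastforce
  have "((\<lambda>s. sin (\<gamma> s)) has_real_derivative w * a t) (at t)"
    using assms(2) DERIV_cong_ev[OF refl ev(2) refl] by blast
  moreover have "((\<lambda>s. sin (\<gamma> s)) has_real_derivative k * a t) (at t)"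
    by (auto intro!: derivative_eq_intros assms(4) simp: ab)
  ultimately have 2: "w * a t = k * a t"
    using DERIV_unique by fastforce
  have "a t \<noteq> 0 \<or> b t \<noteq> 0"
    by (metis ab sin_cos_squared_add add_0 zero_neq_one zero_power2)
  with 1 2 show ?thesis by auto
qed

section \<open>Conservation laws and the deformation field\<close>

lemma trajectory_linkage_H_first_integrals:
  assumes "trajectory (hamiltonian_field linkage_H) I Q" and "is_interval I" and "0 \<in> I" "t \<in> I"
  shows "linkage_H (Q t) = linkage_H (Q 0)"
    and "linkage_G (Q t) = linkage_G (Q 0)"
proof -
  note D = trajectory_linkage_H_derivatives[OF assms(1)]
  have "((\<lambda>t. linkage_H (Q t)) has_real_derivative 0) (at t)" if "t \<in> I" for t
    unfolding linkage_H_eq_velocity by (auto intro!: derivative_eq_intros D that)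
  then show "linkage_H (Q t) = linkage_H (Q 0)"
    using constant_on_interval_if_DERIV_zero[OF assms(2) _ assms(3,4)] by blast
  have "((\<lambda>t. linkage_G (Q t)) has_real_derivative 0) (at t)" if "t \<in> I" for t
    unfolding linkage_G_eq_velocity
    by (auto intro!: derivative_eq_intros D that simp: field_simps)
  then show "linkage_G (Q t) = linkage_G (Q 0)"
    using constant_on_interval_if_DERIV_zero[OF assms(2) _ assms(3,4)] by blast
qed

theorem theorem8:
  fixes Q0 :: phase_point and Q :: "real \<Rightarrow> phase_point" and I :: "real set"
    and g :: real and x \<xi> :: "real \<Rightarrow> real^2"
  assumes "Q0 \<in> cotangent_space"
    and "linkage_H Q0 = 1/2"
    and "g = linkage_G Q0"
    and "open I" and "is_interval I" and "0 \<in> I"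
    and "trajectory (hamiltonian_field linkage_H) I Q"
    and "Q 0 = Q0"
    and "x = (\<lambda>t. base_proj (Q t))"
    and "\<xi> = (\<lambda>t. base_proj (hamiltonian_field linkage_G (Q t)))"
  shows "(\<exists>T N \<kappa>. frenet_frame I x T N \<kappa>) \<and>
    (\<forall>T N \<kappa> u v.
       frenet_frame I x T N \<kappa> \<longrightarrow>
       (\<forall>t\<in>I. \<xi> t = u t *\<^sub>R T t + v t *\<^sub>R N t) \<longrightarrow>
       (\<forall>t\<in>I. u t = 1 + g - 1/2 * (\<kappa> t)\<^sup>2 \<and>
          \<kappa> differentiable (at t) \<and> v t = - deriv \<kappa> t))"
proof -
  define w where "w = (\<lambda>t. turning_rate (Q t))"
  define V where "V = (\<lambda>t. velocity (Q t))"
  define p where "p = (\<lambda>t. momentum (Q t))"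
  note D = trajectory_linkage_H_derivatives[OF assms(7)]
  have dx: "(x has_vector_derivative V t) (at t)" if "t \<in> I" for t
    using D(1)[OF that] by (simp add: assms(9) V_def)
  have dV: "((\<lambda>t. V t $ 1) has_real_derivative - (w t * V t $ 2)) (at t)"
           "((\<lambda>t. V t $ 2) has_real_derivative w t * V t $ 1) (at t)" if "t \<in> I" for t
    using D(3,4)[OF that] by (simp_all add: V_def w_def)
  have dw: "(w has_real_derivative p t $ 1 * V t $ 2 - p t $ 2 * V t $ 1) (at t)"
    if "t \<in> I" for t
    using D(5)[OF that] by (simp add: V_def w_def p_def)
  have unit: "(V t $ 1)\<^sup>2 + (V t $ 2)\<^sup>2 = 1" if "t \<in> I" for t
    using trajectory_linkage_H_first_integrals(1)[OF assms(7,5,6) that] assms(2,8)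
    by (simp add: linkage_H_eq_velocity V_def)
  have G: "p t $ 1 * V t $ 1 + p t $ 2 * V t $ 2 + (w t)\<^sup>2 / 2 = g" if "t \<in> I" for t
    using trajectory_linkage_H_first_integrals(2)[OF assms(7,5,6) that] assms(3,8)
    by (simp add: linkage_G_eq_velocity V_def p_def w_def)
  have \<xi>: "\<xi> t = V t + p t" for t
    by (simp add: assms(10) base_proj_hamiltonian_field_linkage_G V_def p_def)

  have "continuous_on I w"
    by (meson dw DERIV_isCont continuous_at_imp_continuous_on)
  then obtain \<gamma> where \<gamma>: "\<forall>t\<in>I. V t $ 1 = cos (\<gamma> t) \<and> V t $ 2 = sin (\<gamma> t)
      \<and> (\<gamma> has_real_derivative w t) (at t)"
    using rotating_unit_vector_lift[OF assms(4,5) _ dV unit] by blast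
  have "frenet_frame I x V (\<lambda>t. vector [- V t $ 2, V t $ 1]) w"
    unfolding frenet_frame_def
    by (rule exI[of _ \<gamma>]) (use \<gamma> dx in \<open>auto simp: vec_eq_iff forall_2\<close>)
  moreover have "u t = 1 + g - 1/2 * (\<kappa> t)\<^sup>2 \<and> \<kappa> differentiable (at t) \<and> v t = - deriv \<kappa> t"
    if frame: "frenet_frame I x T N \<kappa>"
      and uv: "\<forall>t\<in>I. \<xi> t = u t *\<^sub>R T t + v t *\<^sub>R N t" and "t \<in> I" for T N \<kappa> u v t
  proof -
    obtain \<beta> where \<beta>: "\<And>t. t \<in> I \<Longrightarrow> (x has_vector_derivative T t) (at t)
        \<and> T t = vector [cos (\<beta> t), sin (\<beta> t)] \<and> N t = vector [- sin (\<beta> t), cos (\<beta> t)]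
        \<and> (\<beta> has_real_derivative \<kappa> t) (at t)"
      using frame unfolding frenet_frame_def by blast
    have T: "T s = V s" if "s \<in> I" for s
      using \<beta>[OF that] dx[OF that] vector_derivative_unique_at by blast
    have V\<beta>: "V s $ 1 = cos (\<beta> s) \<and> V s $ 2 = sin (\<beta> s)" if "s \<in> I" for s
      using \<beta>[OF that] T[OF that] by (metis vector_2)
    have \<kappa>: "\<kappa> s = w s" if "s \<in> I" for s
    proof (rule rotation_rate_unique[OF dV[OF that]])
      show "\<forall>\<^sub>F s in nhds s. V s $ 1 = cos (\<beta> s) \<and> V s $ 2 = sin (\<beta> s)"
        using V\<beta> eventually_nhds_in_open[OF assms(4) that] by (auto elim: eventually_mono)
      show "(\<beta> has_real_derivative \<kappa> s) (at s)"
        using \<beta>[OF that] by blast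
    qed
    have "\<forall>\<^sub>F s in nhds t. \<kappa> s = w s"
      using eventually_nhds_in_open[OF assms(4) \<open>t \<in> I\<close>] by eventually_elim (rule \<kappa>)
    then have "(\<kappa> has_real_derivative p t $ 1 * V t $ 2 - p t $ 2 * V t $ 1) (at t)"
      using dw[OF \<open>t \<in> I\<close>] DERIV_cong_ev[OF refl _ refl] by blast
    then have d\<kappa>: "\<kappa> differentiable (at t)" "deriv \<kappa> t = p t $ 1 * V t $ 2 - p t $ 2 * V t $ 1"
      by (auto simp: real_differentiable_def DERIV_imp_deriv)
    have N: "N t $ 1 = - V t $ 2" "N t $ 2 = V t $ 1"
      using \<beta>[OF \<open>t \<in> I\<close>] V\<beta>[OF \<open>t \<in> I\<close>] by simp_all
    \<comment> \<open>Taking inner products of this decomposition with the orthonormal pair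
       \<open>V t\<close>, \<open>N t\<close> isolates the two coefficients.\<close>
    have "V t + p t = u t *\<^sub>R V t + v t *\<^sub>R N t"
      using uv \<open>t \<in> I\<close> T[OF \<open>t \<in> I\<close>] \<xi> by metis
    then have eq: "V t $ 1 + p t $ 1 = u t * V t $ 1 - v t * V t $ 2"
                  "V t $ 2 + p t $ 2 = u t * V t $ 2 + v t * V t $ 1"
      by (simp_all add: vec_eq_iff forall_2 N)
    have "u t = 1 + (p t $ 1 * V t $ 1 + p t $ 2 * V t $ 2)"
      using eq unit[OF \<open>t \<in> I\<close>] by algebra
    then have "u t = 1 + g - 1/2 * (\<kappa> t)\<^sup>2"
      using G[OF \<open>t \<in> I\<close>] \<kappa>[OF \<open>t \<in> I\<close>] by simp
    moreover have "v t = p t $ 2 * V t $ 1 - p t $ 1 * V t $ 2"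
      using eq unit[OF \<open>t \<in> I\<close>] by algebra
    ultimately show ?thesis
      using d\<kappa> by simp
  qed
  ultimately show ?thesis by blast
qed

end
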